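(* Let $k$ and $n$ be positive integers, let $\alpha\in\mathbb{C}$, and let $A$ be a $kn\times n$ complex matrix. Then $$\sum_{\sigma\in\mathfrak{S}_{kn}}\Bigl(-\frac1k\Bigr)^{\nu(\sigma)}\det\nolimits_{\alpha}\bigl(\varpi_k(A)P(\sigma)\bigr)=f_{(k^n)}(\alpha)\,\operatorname{wrdet}_k A .$$
   Context: $\mathfrak{S}_N$ is the symmetric group on $\{1,\dots,N\}$. For $\sigma\in\mathfrak{S}_N$, $\nu(\sigma)$ is $N$ minus the number of disjoint cycles of $\sigma$ (fixed points counted as cycles), and $P(\sigma)=(\delta_{i\,\sigma(j)})_{1\le i,j\le N}$ is the permutation matrix of $\sigma$. For $\alpha\in\mathbb{C}$ and an $N\times N$ complex matrix $B=(b_{ij})$, the $\alpha$-determinant is $$\det\nolimits_{\alpha}B=\sum_{\sigma\in\mathfrak{S}_N}\alpha^{\nu(\sigma)}b_{\sigma(1)1}b_{\sigma(2)2}\cdots b_{\sigma(N)N},$$ with the convention $0^0=1$. For a $kn\times n$ complex matrix $A$, $\varpi_k(A)=A\otimes\mathbf{1}_{1,k}$ is the Kronecker product of $A$ with the $1\times k$ all-one matrix; that is, $\varpi_k(A)$ is the $kn\times kn$ matrix whose columns are $a_1,\dots,a_1,a_2,\dots,a_2,\dots,a_n,\dots,a_n$ (each column $a_j$ of $A$ repeated $k$ times consecutively). The $k$-wreath determinant of $A$ is $\operatorname{wrdet}_kA=\det_{-1/k}\varpi_k(A)$, the $\alpha$-determinant of $\varpi_k(A)$ at $\alpha=-1/k$.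 For a partition $\lambda$, identified with its Young diagram (boxes $(i,j)$ with $i$ the row and $j$ the column index, $1\le j\le\lambda_i$), the modified content polynomial is $f_\lambda(x)=\prod_{(i,j)\in\lambda}(1+(j-i)x)$. The partition $(k^n)$ has $n$ parts, all equal to $k$, so $f_{(k^n)}(x)=\prod_{i=1}^n\prod_{j=1}^k(1+(j-i)x)$. *)

theory Defs
  imports
    Complex_Main
    "HOL-Combinatorics.Orbits"
    "Jordan_Normal_Form.Matrix"
begin

text \<open>
  Matrices are those of Jordan_Normal_Form, so rows and columns are numbered from 0 and
  the symmetric group on \<open>N\<close> letters consists of the \<open>\<sigma>\<close> with \<open>\<sigma> permutes {0..<N}\<close>.
\<close>

text \<open>
  The disjoint cycles of a permutation \<open>\<sigma>\<close> correspond to its orbits; a fixed point contributes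
  a singleton orbit. The subtraction on \<open>nat\<close> does not truncate, as there are at most \<open>N\<close> orbits.
\<close>

definition cycle_count :: "nat \<Rightarrow> (nat \<Rightarrow> nat) \<Rightarrow> nat" where
  "cycle_count N \<sigma> = card (orbit \<sigma> ` {0..<N})"

definition nu :: "nat \<Rightarrow> (nat \<Rightarrow> nat) \<Rightarrow> nat" where
  "nu N \<sigma> = N - cycle_count N \<sigma>"

definition perm_matrix :: "nat \<Rightarrow> (nat \<Rightarrow> nat) \<Rightarrow> complex mat" where
  "perm_matrix N \<sigma> = mat N N (\<lambda>(i, j). if i = \<sigma> j then 1 else 0)"

text \<open>
  As for the library determinant, the value on non-square matrices is \<open>0\<close>.
  The convention \<open>0\<^sup>0 = 1\<close> is built into \<open>power\<close>.
\<close>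

definition alpha_det :: "complex \<Rightarrow> complex mat \<Rightarrow> complex" where
  "alpha_det \<alpha> B =
     (if dim_row B = dim_col B then
        (\<Sum>\<sigma> | \<sigma> permutes {0..<dim_row B}.
           \<alpha> ^ nu (dim_row B) \<sigma> * (\<Prod>j = 0..<dim_row B. B $$ (\<sigma> j, j)))
      else 0)"

definition kronecker :: "'a::semiring_1 mat \<Rightarrow> 'a mat \<Rightarrow> 'a mat" where
  "kronecker A B =
     mat (dim_row A * dim_row B) (dim_col A * dim_col B)
       (\<lambda>(i, j). A $$ (i div dim_row B, j div dim_col B) * B $$ (i mod dim_row B, j mod dim_col B))"

definition all_ones :: "nat \<Rightarrow> nat \<Rightarrow> 'a::semiring_1 mat" where
  "all_ones m n = mat m n (\<lambda>_. 1)"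

definition varpi :: "nat \<Rightarrow> complex mat \<Rightarrow> complex mat" where
  "varpi k A = kronecker A (all_ones 1 k)"

definition wrdet :: "nat \<Rightarrow> complex mat \<Rightarrow> complex" where
  "wrdet k A = alpha_det (- 1 / of_nat k) (varpi k A)"

text \<open>
  A partition is given by the weakly decreasing list of its parts. Boxes are numbered from \<open>(0, 0)\<close>,
  which does not affect the content \<open>j - i\<close> of a box (computed in \<open>int\<close>, since it may be negative).
\<close>

definition young_diagram :: "nat list \<Rightarrow> (nat \<times> nat) set" where
  "young_diagram \<mu> = {(i, j). i < length \<mu> \<and> j < \<mu> ! i}"

definition content_poly :: "nat list \<Rightarrow> complex \<Rightarrow> complex" where
  "content_poly \<mu> x = (\<Prod>(i, j)\<in>young_diagram \<mu>. 1 + of_int (int j - int i) * x)"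

lemma varpi_carrier: "A \<in> carrier_mat m n \<Longrightarrow> varpi k A \<in> carrier_mat m (n * k)"
  by (simp add: varpi_def kronecker_def all_ones_def)

lemma varpi_index:
  assumes "A \<in> carrier_mat m n" "i < m" "j < n * k"
  shows "varpi k A $$ (i, j) = A $$ (i, j div k)"
proof -
  have "k > 0" using assms(3) by (cases k) auto
  then show ?thesis using assms by (simp add: varpi_def kronecker_def all_ones_def)
qed

lemma content_poly_rectangle:
  "content_poly (replicate n k) x = (\<Prod>i = 1..n. \<Prod>j = 1..k. 1 + of_int (int j - int i) * x)"
proof -
  have "young_diagram (replicate n k) = {..<n} \<times> {..<k}"
    by (auto simp: young_diagram_def)
  then have "content_poly (replicate n k) x =
      (\<Prod>i<n. \<Prod>j<k. 1 + of_int (int (Suc j) - int (Suc i)) * x)"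
    by (simp add: content_poly_def prod.cartesian_product)
  also have "\<dots> = (\<Prod>i = 1..n. \<Prod>j = 1..k. 1 + of_int (int j - int i) * x)"
    by (simp only: prod.atLeast1_atMost_eq One_nat_def)
  finally show ?thesis .
qed

end

theory Submission
  imports Defs
begin

text \<open>
  Let \<open>c = - 1 / k\<close>, \<open>N = k * n\<close>, and let \<open>w p = \<Prod>j. B $$ (p j, j)\<close> for \<open>B = varpi k A\<close>. Permuting the
  columns of \<open>B\<close> by \<open>\<sigma>\<close> replaces \<open>w p\<close> by \<open>w (p \<circ> inv \<sigma>)\<close>, so after exchanging the two sums the left
  hand side is \<open>\<Sum>p. \<alpha> ^ nu p * G p\<close>, where \<open>G p = \<Sum>s. c ^ nu s * w (p \<circ> s)\<close> is the convolution of
  \<open>w\<close> with the class function \<open>c ^ nu\<close>. The value \<open>G id\<close> is the wreath determinant. It remains to see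
  that \<open>G\<close> is an eigenvector of convolution with \<open>\<alpha> ^ nu\<close>, with the content polynomial as eigenvalue.

  In the group algebra, \<open>\<Sum>p. \<alpha> ^ nu p * p\<close> is the product over \<open>i\<close> of \<open>1 + \<alpha> * J i\<close>, where the
  Jucys--Murphy element \<open>J i\<close> is the sum of the transpositions of \<open>i\<close> with the letters \<open>b < i\<close>. Hence it
  suffices that \<open>G\<close> is a simultaneous eigenvector of the \<open>J i\<close> and that the eigenvalue at \<open>i\<close> is the
  content of box \<open>i\<close> of the \<open>n\<close> by \<open>k\<close> rectangle read row by row (\<open>nu_conv_jucys_murphy\<close>,
  \<open>sum_power_nu_eigenvalues\<close>). Two properties of \<open>G\<close> give this:

  \<^item> The columns of \<open>B\<close> come in \<open>n\<close> blocks of \<open>k\<close> equal columns, so \<open>w\<close> and with it \<open>G\<close> are right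
    invariant under permutations inside a block (\<open>nu_conv_right_invariant\<close>). A transposition of \<open>i\<close>
    with a letter of its own block therefore fixes \<open>G\<close>.

  \<^item> The sum of \<open>G\<close> over a coset of the symmetric group on any \<open>k + 1\<close> letters vanishes
    (\<open>sum_nu_conv_eq_0\<close>), because the product \<open>\<Prod>i\<le>k. 1 + i * c\<close>, which is \<open>0\<close>, appears as a factor. Taking a block
    together with one further letter \<open>i\<close>, and using invariance under the block, the transpositions of
    \<open>i\<close> with the letters of that block act on \<open>G\<close> as \<open>- 1\<close> in total
    (\<open>sum_nu_conv_transpose_block\<close>).

  If \<open>i\<close> lies in block \<open>l\<close> with \<open>j\<close> earlier letters in that block, \<open>J i\<close> thus acts as \<open>j - l\<close>.
\<close>

\<comment> \<open>Otherwise \<open>inv\<close> denotes the inverse in a group structure and not that of a function.\<close>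
unbundle no m_inv_syntax

section \<open>Cycles of products of permutations\<close>

lemma nu_id: "nu N id = 0"
proof -
  have "orbit id x = {x}" for x :: nat
    by (simp add: orbit_eq_singleton_iff)
  then have "orbit id ` {0..<N} = (\<lambda>x. {x}) ` {0..<N}"
    by simp
  then show ?thesis
    by (simp add: nu_def cycle_count_def card_image)
qed

lemma nu_inv:
  assumes "p permutes {0..<N}"
  shows "nu N (inv p) = nu N p"
proof -
  have "permutation p"
    using assms by (auto simp: permutation_permutes)
  then show ?thesis
    by (simp add: nu_def cycle_count_def orbit_inv_eq)
qed

lemma nu_conjugate:
  assumes p: "p permutes {0..<N}" and h: "h permutes {0..<N}"
  shows "nu N (h \<circ> p \<circ> inv h) = nu N p"
proof -
  let ?q = "h \<circ> p \<circ> inv h"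
  have "permutation p"
    using p by (auto simp: permutation_permutes)
  then have orb: "orbit ?q (h x) = h ` orbit p x" for x
    using orbit_inverse[of x p ?q h] permutes_inverses[OF h]
    by (simp add: permutation_self_in_orbit)
  have "orbit ?q ` {0..<N} = orbit ?q ` h ` {0..<N}"
    by (simp add: permutes_image[OF h])
  also have "\<dots> = (`) h ` orbit p ` {0..<N}"
    by (simp add: image_image orb)
  finally have "cycle_count N ?q = card ((`) h ` orbit p ` {0..<N})"
    by (simp add: cycle_count_def)
  also have "\<dots> = cycle_count N p"
    unfolding cycle_count_def
    by (rule card_image) (simp add: inj_on_def inj_image_eq_iff[OF permutes_inj[OF h]])
  finally show ?thesis
    by (simp add: nu_def)
qed

lemma nu_commute:
  assumes p: "p permutes {0..<N}" and q: "q permutes {0..<N}"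
  shows "nu N (p \<circ> q) = nu N (q \<circ> p)"
proof -
  have "p \<circ> (q \<circ> p) \<circ> inv p = p \<circ> q"
    using permutes_inverses[OF p] by (simp add: fun_eq_iff)
  then show ?thesis
    using nu_conjugate[OF permutes_compose[OF p q] p] by simp
qed

text \<open>
  Composing with \<open>transpose x a\<close> inserts the fixed point \<open>x\<close> of \<open>p\<close> into the cycle of \<open>a\<close>, so the
  two cycles \<open>{x}\<close> and \<open>orbit p a\<close> merge and all other cycles stay as they are.
\<close>

lemma nu_transpose_fixed_point:
  assumes p: "p permutes {0..<N}" and fixed: "p x = x" and "x < N" "a < N" "a \<noteq> x"
  shows "nu N (transpose x a \<circ> p) = Suc (nu N p)"
proof -
  let ?S = "{0..<N}"
  define f where "f = transpose x a \<circ> p"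
  have f: "f permutes ?S"
    unfolding f_def using assms by (intro permutes_compose permutes_swap_id) auto
  have perm: "permutation p" "permutation f"
    using p f by (auto simp: permutation_permutes)
  have fx: "f x = a"
    using fixed by (simp add: f_def)
  have p_neq: "p y \<noteq> x" if "y \<noteq> x" for y
    using that fixed permutes_inj[OF p] by (metis injD)
  have fy: "f y = (if p y = a then x else p y)" if "y \<noteq> x" for y
    using p_neq[OF that] by (simp add: f_def)
  have not_in: "x \<notin> orbit p y" if "y \<noteq> x" for y
  proof
    assume "x \<in> orbit p y"
    then have "orbit p x = orbit p y"
      by (metis cyclic_on_orbit' orbit_cyclic_eq3 perm(1))
    then show False
      using that fixed permutation_self_in_orbit[OF perm(1), of y]
      by (metis orbit_eq_singleton_iff singletonD)
  qed
  have orb: "orbit p y = orbit f y - {x}" if "y \<noteq> x" for y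
  proof (intro equalityI subsetI)
    fix z assume "z \<in> orbit p y"
    then have "z \<in> orbit f y"
    proof induction
      case base
      show ?case
        using fx fy[OF that] by (metis orbit.base orbit.step)
    next
      case (step z)
      then have "z \<noteq> x"
        using not_in[OF that] by blast
      then show ?case
        using fx fy step.IH by (metis orbit.step)
    qed
    moreover have "z \<noteq> x"
      using \<open>z \<in> orbit p y\<close> not_in[OF that] by blast
    ultimately show "z \<in> orbit f y - {x}" by simp
  next
    fix z assume z: "z \<in> orbit f y - {x}"
    \<comment> \<open>The cycle of \<open>f\<close> reaches \<open>x\<close> immediately before \<open>a\<close>, so \<open>a\<close> stands in for \<open>x\<close>.\<close>
    have "z \<in> orbit f y \<Longrightarrow> (if z = x then a else z) \<in> orbit p y"
    proof (induction rule: orbit.induct)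
      case base
      show ?case
        using fy[OF that] p_neq[OF that] by (auto intro: orbit_eqI)
    next
      case (step z)
      then show ?case
      proof (cases "z = x")
        case True
        then show ?thesis using step fx \<open>a \<noteq> x\<close> by simp
      next
        case False
        then have "p z \<in> orbit p y"
          using step by (auto intro: orbit.step)
        then show ?thesis
          using fy[OF False] p_neq[OF False] by auto
      qed
    qed
    then show "z \<in> orbit p y"
      using z by simp
  qed
  have "orbit f x = orbit f a"
    using permutation_orbit_step[OF perm(2), of x] fx by simp
  then have f_image: "orbit f ` ?S = orbit f ` (?S - {x})"
    using \<open>a < N\<close> \<open>a \<noteq> x\<close> \<open>x < N\<close> image_insert[of "orbit f" x "?S - {x}"]
    by (simp add: insert_absorb)
  have inj: "inj_on (\<lambda>X. X - {x}) (orbit f ` (?S - {x}))"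
  proof (rule inj_onI)
    fix X Y assume "X \<in> orbit f ` (?S - {x})" "Y \<in> orbit f ` (?S - {x})"
      and eq: "X - {x} = Y - {x}"
    then obtain y y' where "y \<noteq> x" and XY: "X = orbit f y" "Y = orbit f y'"
      by auto
    then have "y \<in> Y"
      using eq permutation_self_in_orbit[OF perm(2), of y] by blast
    then show "X = Y"
      using XY by (metis cyclic_on_orbit' orbit_cyclic_eq3 perm(2))
  qed
  have "orbit p ` ?S = insert (orbit p x) (orbit p ` (?S - {x}))"
    using \<open>x < N\<close> by auto
  also have "orbit p x = {x}"
    using fixed by (simp add: orbit_eq_singleton_iff)
  also have "orbit p ` (?S - {x}) = (\<lambda>X. X - {x}) ` orbit f ` (?S - {x})"
    by (auto simp: image_image orb)
  finally have "orbit p ` ?S = insert {x} ((\<lambda>X. X - {x}) ` orbit f ` ?S)"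
    by (simp add: f_image)
  moreover have "{x} \<notin> (\<lambda>X. X - {x}) ` orbit f ` ?S"
    by auto
  ultimately have "cycle_count N p = Suc (card ((\<lambda>X. X - {x}) ` orbit f ` ?S))"
    by (simp add: cycle_count_def)
  also have "\<dots> = Suc (cycle_count N f)"
    using inj by (simp add: cycle_count_def f_image card_image)
  finally have "cycle_count N p = Suc (cycle_count N f)" .
  moreover have "cycle_count N p \<le> N"
    unfolding cycle_count_def using card_image_le[of ?S "orbit p"] by simp
  ultimately show ?thesis
    by (simp add: nu_def f_def)
qed

section \<open>Sums over permutations weighted by powers of nu\<close>

lemma sum_over_permutations_insert_right:
  assumes "finite S" "a \<notin> S"
  shows "(\<Sum>p | p permutes insert a S. f p) =
    (\<Sum>b\<in>insert a S. \<Sum>q | q permutes S. f (q \<circ> transpose a b))"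
proof -
  have "(\<Sum>p | p permutes insert a S. f p) = (\<Sum>p | p permutes insert a S. f (inv p))"
    by (rule sum_permutations_inverse)
  also have "\<dots> = (\<Sum>b\<in>insert a S. \<Sum>q | q permutes S. f (inv (transpose a b \<circ> q)))"
    by (rule sum_over_permutations_insert[OF assms])
  also have "\<dots> = (\<Sum>b\<in>insert a S. \<Sum>q | q permutes S. f (inv q \<circ> transpose a b))"
    by (intro sum.cong refl) (simp add: o_inv_distrib permutes_bij)
  also have "\<dots> = (\<Sum>b\<in>insert a S. \<Sum>q | q permutes S. f (q \<circ> transpose a b))"
    by (intro sum.cong refl sum_permutations_inverse[symmetric])
  finally show ?thesis .
qed

text \<open>
  The Jucys--Murphy recursion: every permutation of \<open>insert x S\<close> is uniquely \<open>q\<close> or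
  \<open>q \<circ> transpose x b\<close> with \<open>q\<close> a permutation of \<open>S\<close>, and the second kind costs one factor \<open>\<beta>\<close>.
\<close>

lemma sum_power_nu_insert:
  fixes F :: "(nat \<Rightarrow> nat) \<Rightarrow> complex"
  assumes S: "insert x S \<subseteq> {0..<N}" and "x \<notin> S"
  shows "(\<Sum>p | p permutes insert x S. \<beta> ^ nu N p * F p) =
    (\<Sum>q | q permutes S. \<beta> ^ nu N q * (F q + \<beta> * (\<Sum>b\<in>S. F (q \<circ> transpose x b))))"
proof -
  have fin: "finite S"
    using S by (auto intro: finite_subset[of S "{0..<N}"])
  have nu: "nu N (q \<circ> transpose x b) = Suc (nu N q)" if "q permutes S" "b \<in> S" for q b
  proof -
    have "S \<subseteq> {0..<N}"
      using S by simp
    then have q: "q permutes {0..<N}"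
      by (rule permutes_subset[OF that(1)])
    have t: "transpose x b permutes {0..<N}"
      using that(2) S by (intro permutes_swap_id) auto
    have "nu N (transpose x b \<circ> q) = Suc (nu N q)"
    proof (rule nu_transpose_fixed_point[OF q])
      show "q x = x"
        using \<open>x \<notin> S\<close> by (rule permutes_not_in[OF that(1)])
    qed (use that(2) S \<open>x \<notin> S\<close> in auto)
    then show ?thesis
      by (simp only: nu_commute[OF q t])
  qed
  have "(\<Sum>p | p permutes insert x S. \<beta> ^ nu N p * F p) =
      (\<Sum>q | q permutes S. \<beta> ^ nu N q * F q) +
      (\<Sum>b\<in>S. \<Sum>q | q permutes S. \<beta> ^ nu N (q \<circ> transpose x b) * F (q \<circ> transpose x b))"
    using fin \<open>x \<notin> S\<close> by (simp add: sum_over_permutations_insert_right)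
  also have "(\<Sum>b\<in>S. \<Sum>q | q permutes S. \<beta> ^ nu N (q \<circ> transpose x b) * F (q \<circ> transpose x b)) =
      (\<Sum>b\<in>S. \<Sum>q | q permutes S. \<beta> ^ nu N q * (\<beta> * F (q \<circ> transpose x b)))"
    by (intro sum.cong refl) (simp add: nu mult_ac)
  also have "\<dots> = (\<Sum>q | q permutes S. \<beta> ^ nu N q * (\<beta> * (\<Sum>b\<in>S. F (q \<circ> transpose x b))))"
    by (subst sum.swap) (simp add: sum_distrib_left)
  finally show ?thesis
    by (simp add: sum.distrib distrib_left)
qed

lemma sum_power_nu:
  assumes "K \<subseteq> {0..<N}"
  shows "(\<Sum>p | p permutes K. \<beta> ^ nu N p) = (\<Prod>i<card K. 1 + of_nat i * \<beta> :: complex)"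
proof -
  have "finite K"
    using assms finite_subset by blast
  then show ?thesis
    using assms
  proof (induction K)
    case empty
    then show ?case by (simp add: nu_id flip: id_def)
  next
    case (insert x S)
    have "(\<Sum>p | p permutes insert x S. \<beta> ^ nu N p) =
        (\<Sum>q | q permutes S. \<beta> ^ nu N q * (1 + \<beta> * of_nat (card S)))"
      using sum_power_nu_insert[of x S N \<beta> "\<lambda>_. 1"] insert by simp
    also have "\<dots> = (\<Prod>i<card S. 1 + of_nat i * \<beta>) * (1 + of_nat (card S) * \<beta>)"
      using insert by (simp add: mult.commute[of \<beta>] flip: sum_distrib_right)
    finally show ?case
      using insert by simp
  qed
qed

text \<open>
  A letter \<open>x\<close> outside \<open>K\<close> is split off by writing \<open>s = transpose x (s x) \<circ> s'\<close> with \<open>s'\<close> fixing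
  \<open>x\<close>. A permutation \<open>g\<close> of \<open>K\<close> multiplied on the right does not disturb this factorization, as
  \<open>s' \<circ> g\<close> still fixes \<open>x\<close>; so the transposition raises \<open>nu\<close> by the same amount for all \<open>g\<close>. What is
  left in the end is \<open>r\<close>, and \<open>m\<close> counts the transpositions that were not trivial.
\<close>

lemma nu_mult_reduce:
  assumes "finite R" "s permutes R \<union> K" "R \<inter> K = {}" "R \<union> K \<subseteq> {0..<N}"
  shows "\<exists>r m. r permutes K \<and> (\<forall>g. g permutes K \<longrightarrow> nu N (s \<circ> g) = m + nu N (r \<circ> g))"
  using assms
proof (induction R arbitrary: s)
  case empty
  then show ?case by (intro exI[of _ s] exI[of _ 0]) simp
next
  case (insert x R)
  define s' where "s' = transpose x (s x) \<circ> s"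
  have s': "s' permutes R \<union> K"
    unfolding s'_def using insert.prems by (intro permutes_insert_lemma) simp
  have "R \<inter> K = {}" "R \<union> K \<subseteq> {0..<N}"
    using insert.prems by auto
  then obtain r m where r: "r permutes K"
    and m: "\<And>g. g permutes K \<Longrightarrow> nu N (s' \<circ> g) = m + nu N (r \<circ> g)"
    using insert.IH[OF s'] by blast
  have s_eq: "s = transpose x (s x) \<circ> s'"
    by (simp add: s'_def fun_eq_iff)
  have "nu N (s \<circ> g) = ((if s x = x then 0 else 1) + m) + nu N (r \<circ> g)" if g: "g permutes K" for g
  proof (cases "s x = x")
    case True
    then have "s = s'"
      using s_eq by simp
    then show ?thesis
      using True m[OF g] by simp
  next
    case False
    have "s' \<circ> g permutes R \<union> K"
      using s' g by (auto intro: permutes_compose permutes_subset)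
    moreover have "x \<notin> R \<union> K"
      using insert by auto
    ultimately have sg: "s' \<circ> g permutes {0..<N}" "(s' \<circ> g) x = x"
      using insert.prems permutes_not_in[of "s' \<circ> g"] by (auto intro: permutes_subset)
    have "s x \<in> insert x R \<union> K"
      using insert.prems(1) permutes_in_image[of s "insert x R \<union> K" x] by simp
    then have "s x < N" "x < N"
      using insert.prems(3) by auto
    then have "nu N (transpose x (s x) \<circ> (s' \<circ> g)) = Suc (nu N (s' \<circ> g))"
      by (intro nu_transpose_fixed_point sg False)
    then show ?thesis
      using False m[OF g] s_eq by (simp add: comp_assoc[symmetric])
  qed
  then show ?case
    using r by blast
qed

text \<open>
  The reduction to \<open>K\<close> makes the sum a multiple of the sum over the symmetric group of \<open>K\<close> itself,
  which is \<open>\<Prod>i\<le>k. 1 - i / k\<close>; its last factor vanishes.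
\<close>

lemma sum_coset_power_nu_eq_0:
  assumes "k \<ge> 1" "K \<subseteq> {0..<N}" "card K = Suc k" "s permutes {0..<N}"
  shows "(\<Sum>g | g permutes K. (- 1 / of_nat k :: complex) ^ nu N (s \<circ> g)) = 0"
proof -
  let ?c = "- 1 / of_nat k :: complex"
  have eq: "({0..<N} - K) \<union> K = {0..<N}"
    using assms by auto
  obtain r m where r: "r permutes K"
    and m: "\<And>g. g permutes K \<Longrightarrow> nu N (s \<circ> g) = m + nu N (r \<circ> g)"
    using nu_mult_reduce[of "{0..<N} - K" s K N] assms eq by auto
  have "(\<Sum>g | g permutes K. ?c ^ nu N (s \<circ> g)) = (\<Sum>g | g permutes K. ?c ^ m * ?c ^ nu N (r \<circ> g))"
    by (intro sum.cong) (auto simp: m power_add)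
  also have "\<dots> = ?c ^ m * (\<Sum>g | g permutes K. ?c ^ nu N (r \<circ> g))"
    by (simp add: sum_distrib_left)
  also have "(\<Sum>g | g permutes K. ?c ^ nu N (r \<circ> g)) = (\<Sum>g | g permutes K. ?c ^ nu N g)"
    by (rule setum_permutations_compose_left[OF r, symmetric])
  also have "\<dots> = 0"
    using assms by (simp add: sum_power_nu)
  finally show ?thesis
    by (simp only: mult_zero_right)
qed

section \<open>Convolution with a class function\<close>

definition nu_conv :: "nat \<Rightarrow> complex \<Rightarrow> ((nat \<Rightarrow> nat) \<Rightarrow> complex) \<Rightarrow> (nat \<Rightarrow> nat) \<Rightarrow> complex" where
  "nu_conv N \<beta> w p = (\<Sum>s | s permutes {0..<N}. \<beta> ^ nu N s * w (p \<circ> s))"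

text \<open>
  As \<open>nu\<close> is a class function, replacing \<open>s\<close> by its conjugate \<open>inv h \<circ> s \<circ> h\<close> moves \<open>h\<close> from the left
  of \<open>s\<close> to its right, where \<open>w\<close> absorbs it.
\<close>

lemma nu_conv_right_invariant:
  assumes p: "p permutes {0..<N}" and h: "h permutes {0..<N}"
    and w: "\<And>r. r permutes {0..<N} \<Longrightarrow> w (r \<circ> h) = w r"
  shows "nu_conv N \<beta> w (p \<circ> h) = nu_conv N \<beta> w p"
proof -
  have "nu_conv N \<beta> w (p \<circ> h) = (\<Sum>s | s permutes {0..<N}. \<beta> ^ nu N (inv h \<circ> s) * w (p \<circ> s))"
    unfolding nu_conv_def
    by (subst setum_permutations_compose_left[OF permutes_inv[OF h]])
       (simp add: comp_assoc[symmetric] permutes_inv_o[OF h] comp_assoc[of p h "inv h"])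
  also have "\<dots> = (\<Sum>s | s permutes {0..<N}. \<beta> ^ nu N (inv h \<circ> (s \<circ> h)) * w (p \<circ> (s \<circ> h)))"
    by (rule sum_permutations_compose_right[OF h])
  also have "\<dots> = nu_conv N \<beta> w p"
    unfolding nu_conv_def
  proof (intro sum.cong refl)
    fix s assume "s \<in> {s. s permutes {0..<N}}"
    then have s: "s permutes {0..<N}" by simp
    have "nu N (inv h \<circ> (s \<circ> h)) = nu N s"
      using nu_conjugate[OF s permutes_inv[OF h]]
      by (simp add: inv_inv_eq permutes_bij[OF h] comp_assoc)
    moreover have "w (p \<circ> (s \<circ> h)) = w (p \<circ> s)"
      using w[OF permutes_compose[OF s p]] by (simp add: comp_assoc)
    ultimately show "\<beta> ^ nu N (inv h \<circ> (s \<circ> h)) * w (p \<circ> (s \<circ> h)) = \<beta> ^ nu N s * w (p \<circ> s)"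
      by simp
  qed
  finally show ?thesis .
qed

text \<open>
  Absorbing \<open>g\<close> into the summation variable of the convolution leaves \<open>w\<close> untouched and turns its
  coefficient into the sum of a power of \<open>nu\<close> over a coset of the symmetric group of \<open>K\<close>.
\<close>

lemma sum_nu_conv_eq_0:
  assumes "k \<ge> 1" and K: "K \<subseteq> {0..<N}" "card K = Suc k" and p: "p permutes {0..<N}"
  shows "(\<Sum>g | g permutes K. nu_conv N (- 1 / of_nat k) w (p \<circ> g)) = 0"
proof -
  let ?c = "- 1 / of_nat k :: complex"
  have g_perm: "g permutes {0..<N}" if "g permutes K" for g
    using that K by (auto intro: permutes_subset)
  have "nu_conv N ?c w (p \<circ> g) = (\<Sum>s | s permutes {0..<N}. ?c ^ nu N (s \<circ> inv g) * w (p \<circ> s))"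
    if "g permutes K" for g
  proof -
    note h = g_perm[OF that]
    have "nu_conv N ?c w (p \<circ> g) = (\<Sum>s | s permutes {0..<N}. ?c ^ nu N (inv g \<circ> s) * w (p \<circ> s))"
      unfolding nu_conv_def
      by (subst setum_permutations_compose_left[OF permutes_inv[OF h]])
         (simp add: comp_assoc[symmetric] permutes_inv_o[OF h] comp_assoc[of p g "inv g"])
    also have "\<dots> = (\<Sum>s | s permutes {0..<N}. ?c ^ nu N (s \<circ> inv g) * w (p \<circ> s))"
      by (intro sum.cong refl) (simp add: nu_commute[OF permutes_inv[OF h]])
    finally show ?thesis .
  qed
  then have "(\<Sum>g | g permutes K. nu_conv N ?c w (p \<circ> g)) =
      (\<Sum>g | g permutes K. \<Sum>s | s permutes {0..<N}. ?c ^ nu N (s \<circ> inv g) * w (p \<circ> s))"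
    by simp
  also have "\<dots> =
      (\<Sum>s | s permutes {0..<N}. (\<Sum>g | g permutes K. ?c ^ nu N (s \<circ> inv g)) * w (p \<circ> s))"
    by (subst sum.swap) (simp add: sum_distrib_right)
  also have "\<dots> = (\<Sum>s | s permutes {0..<N}. (\<Sum>g | g permutes K. ?c ^ nu N (s \<circ> g)) * w (p \<circ> s))"
    by (subst (2) sum_permutations_inverse) simp
  also have "\<dots> = 0"
  proof (intro sum.neutral ballI)
    fix s assume "s \<in> {s. s permutes {0..<N}}"
    then have "(\<Sum>g | g permutes K. ?c ^ nu N (s \<circ> g)) = 0"
      by (intro sum_coset_power_nu_eq_0[OF \<open>k \<ge> 1\<close> K]) simp
    then show "(\<Sum>g | g permutes K. ?c ^ nu N (s \<circ> g)) * w (p \<circ> s) = 0"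
      by (simp only: mult_zero_left)
  qed
  finally show ?thesis .
qed

text \<open>
  The symmetric group of \<open>insert i B\<close>, a set of \<open>k + 1\<close> letters, is the disjoint union of the cosets
  of \<open>transpose i b\<close>, \<open>b \<in> insert i B\<close>, modulo the symmetric group of \<open>B\<close>. The convolution is
  constant on each of them, so the vanishing of its total sum leaves a relation among the
  representatives; \<open>b = i\<close> contributes the value at \<open>p\<close>.
\<close>

lemma sum_nu_conv_transpose_block:
  assumes "k \<ge> 1" and B: "B \<subseteq> {0..<N}" "card B = k" and i: "i < N" "i \<notin> B"
    and p: "p permutes {0..<N}"
    and w: "\<And>r h. r permutes {0..<N} \<Longrightarrow> h permutes B \<Longrightarrow> w (r \<circ> h) = w r"
  shows "(\<Sum>b\<in>B. nu_conv N (- 1 / of_nat k) w (p \<circ> transpose i b)) = - nu_conv N (- 1 / of_nat k) w p"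
proof -
  let ?G = "nu_conv N (- 1 / of_nat k) w"
  have fin: "finite B"
    using B finite_subset by blast
  have "0 = (\<Sum>g | g permutes insert i B. ?G (p \<circ> g))"
    using sum_nu_conv_eq_0[of k "insert i B" N p w] assms fin by simp
  also have "\<dots> = (\<Sum>b\<in>insert i B. \<Sum>q | q permutes B. ?G (p \<circ> (transpose i b \<circ> q)))"
    by (rule sum_over_permutations_insert[OF fin i(2)])
  also have "\<dots> = (\<Sum>b\<in>insert i B. \<Sum>q | q permutes B. ?G (p \<circ> transpose i b))"
  proof (intro sum.cong refl)
    fix b q assume "b \<in> insert i B" "q \<in> {q. q permutes B}"
    then have "p \<circ> transpose i b permutes {0..<N}" "q permutes {0..<N}" "q permutes B"
      using p i B by (auto intro!: permutes_compose permutes_swap_id intro: permutes_subset)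
    then show "?G (p \<circ> (transpose i b \<circ> q)) = ?G (p \<circ> transpose i b)"
      using nu_conv_right_invariant w by (simp add: comp_assoc[symmetric])
  qed
  also have "\<dots> = fact k * (\<Sum>b\<in>insert i B. ?G (p \<circ> transpose i b))"
    using card_permutations[OF B(2) fin] by (simp add: sum_distrib_left)
  finally have "(\<Sum>b\<in>insert i B. ?G (p \<circ> transpose i b)) = 0"
    by simp
  then show ?thesis
    using fin i by (simp add: eq_neg_iff_add_eq_0 add.commute)
qed

section \<open>Eigenvalues of the Jucys--Murphy elements\<close>

text \<open>
  In the rectangle read row by row, \<open>i\<close> stands in row \<open>i div k\<close> and column \<open>i mod k\<close>. The
  \<open>i mod k\<close> earlier letters of its row contribute \<open>1\<close> each, every earlier row contributes \<open>- 1\<close> in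
  total.
\<close>

lemma nu_conv_jucys_murphy:
  assumes "k \<ge> 1" and i: "i < n * k" and p: "p permutes {0..<n * k}"
    and w: "\<And>r h l. r permutes {0..<n * k} \<Longrightarrow> l < n \<Longrightarrow> h permutes {l * k..<l * k + k}
      \<Longrightarrow> w (r \<circ> h) = w r"
  defines "G \<equiv> nu_conv (n * k) (- 1 / of_nat k) w"
  shows "(\<Sum>b<i. G (p \<circ> transpose i b)) = of_int (int (i mod k) - int (i div k)) * G p"
proof -
  let ?q = "i div k"
  have q: "?q < n"
    using i by (simp add: less_mult_imp_div_less)
  have block_subset: "{l * k..<l * k + k} \<subseteq> {0..<n * k}" if "l < n" for l
  proof -
    have "Suc l * k \<le> n * k"
      using that by (intro mult_le_mono1) simp
    then show ?thesis by auto
  qed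
  have earlier: "(\<Sum>b = l * k..<l * k + k. G (p \<circ> transpose i b)) = - G p" if l: "l < ?q" for l
  proof -
    have ln: "l < n"
      using l q by simp
    have "Suc l * k \<le> ?q * k"
      using l by (intro mult_le_mono1) simp
    then have "l * k + k \<le> i"
      using div_times_less_eq_dividend[of i k] by (metis add.commute le_trans mult_Suc)
    then show ?thesis
      unfolding G_def
      using assms(1) i p ln by (intro sum_nu_conv_transpose_block block_subset) (auto intro: w[OF _ ln])
  qed
  have same: "G (p \<circ> transpose i b) = G p" if b: "b \<in> {?q * k..<i}" for b
  proof -
    have "i < ?q * k + k"
      using dividend_less_div_times[of k i] assms(1) by simp
    then have ib: "{i, b} \<subseteq> {?q * k..<?q * k + k}"
      using b by auto
    then have "transpose i b permutes {?q * k..<?q * k + k}"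
      by (intro permutes_swap_id) auto
    moreover from this have "transpose i b permutes {0..<n * k}"
      using block_subset[OF q] by (rule permutes_subset)
    ultimately show ?thesis
      unfolding G_def using p q w by (intro nu_conv_right_invariant) auto
  qed
  have "{..<i} = {..<?q * k} \<union> {?q * k..<i}"
    using div_times_less_eq_dividend[of i k] by (simp add: ivl_disj_un_one(2))
  then have "(\<Sum>b<i. G (p \<circ> transpose i b)) =
      (\<Sum>b<?q * k. G (p \<circ> transpose i b)) + (\<Sum>b = ?q * k..<i. G (p \<circ> transpose i b))"
    by (metis finite_atLeastLessThan finite_lessThan ivl_disj_int_one(2) sum.union_disjoint)
  also have "(\<Sum>b<?q * k. G (p \<circ> transpose i b)) = (\<Sum>l<?q. - G p)"
    by (subst sum.nat_group[symmetric]) (simp add: earlier)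
  also have "(\<Sum>b = ?q * k..<i. G (p \<circ> transpose i b)) = (\<Sum>b = ?q * k..<i. G p)"
    by (intro sum.cong refl same)
  also have "\<dots> = of_nat (i mod k) * G p"
    by (simp add: minus_div_mult_eq_mod)
  also have "(\<Sum>l<?q. - G p) + of_nat (i mod k) * G p =
      of_int (int (i mod k) - int ?q) * G p"
    by (simp add: algebra_simps)
  finally show ?thesis .
qed

text \<open>
  Peeling off the largest letter by \<open>sum_power_nu_insert\<close> produces one factor \<open>1 + e i * \<alpha>\<close> at a
  time.
\<close>

lemma sum_power_nu_eigenvalues:
  fixes G :: "(nat \<Rightarrow> nat) \<Rightarrow> complex"
  assumes eig: "\<And>i p. i < N \<Longrightarrow> p permutes {0..<N} \<Longrightarrow>
      (\<Sum>b<i. G (p \<circ> transpose i b)) = e i * G p"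
    and "m \<le> N"
  shows "(\<Sum>p | p permutes {0..<m}. \<alpha> ^ nu N p * G p) = (\<Prod>i<m. 1 + e i * \<alpha>) * G id"
  using \<open>m \<le> N\<close>
proof (induction m)
  case 0
  then show ?case by (simp add: nu_id flip: id_def)
next
  case (Suc m)
  have "(\<Sum>p | p permutes {0..<Suc m}. \<alpha> ^ nu N p * G p) =
      (\<Sum>q | q permutes {0..<m}. \<alpha> ^ nu N q * (G q + \<alpha> * (\<Sum>b\<in>{0..<m}. G (q \<circ> transpose m b))))"
    using sum_power_nu_insert[of m "{0..<m}" N \<alpha> G] Suc.prems
    by (simp add: atLeast0_lessThan_Suc subset_eq)
  also have "\<dots> = (\<Sum>q | q permutes {0..<m}. (1 + e m * \<alpha>) * (\<alpha> ^ nu N q * G q))"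
  proof (intro sum.cong refl)
    fix q assume "q \<in> {q. q permutes {0..<m}}"
    then have "q permutes {0..<N}"
      using Suc.prems by (auto intro: permutes_subset)
    then have "(\<Sum>b\<in>{0..<m}. G (q \<circ> transpose m b)) = e m * G q"
      using eig[of m q] Suc.prems by (simp add: lessThan_atLeast0)
    then show "\<alpha> ^ nu N q * (G q + \<alpha> * (\<Sum>b\<in>{0..<m}. G (q \<circ> transpose m b))) =
        (1 + e m * \<alpha>) * (\<alpha> ^ nu N q * G q)"
      by (simp add: algebra_simps)
  qed
  also have "\<dots> = (\<Prod>i<Suc m. 1 + e i * \<alpha>) * G id"
    using Suc.IH[OF Suc_leD[OF Suc.prems]]
    by (simp only: sum_distrib_left[symmetric] prod.lessThan_Suc mult.commute[of "\<Prod>i<m. _ i"] mult.assoc)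
  finally show ?case .
qed

lemma content_poly_rectangle_row_reading:
  assumes "k \<ge> 1"
  shows "content_poly (replicate n k) x =
    (\<Prod>i<n * k. 1 + of_int (int (i mod k) - int (i div k)) * x)"
proof -
  have "(\<Prod>i<n * k. 1 + of_int (int (i mod k) - int (i div k)) * x) =
      (\<Prod>l<n. \<Prod>i = l * k..<l * k + k. 1 + of_int (int (i mod k) - int (i div k)) * x)"
    by (rule prod.nat_group[symmetric])
  also have "\<dots> = (\<Prod>l<n. \<Prod>j<k. 1 + of_int (int j - int l) * x)"
  proof (rule prod.cong[OF refl])
    fix l
    have shift: "(\<Prod>i = l * k..<l * k + k. f i) = (\<Prod>j<k. f (l * k + j))" for f :: "nat \<Rightarrow> complex"
      using prod.shift_bounds_nat_ivl[of f 0 "l * k" k]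
      by (simp add: add.commute lessThan_atLeast0)
    have "(\<Prod>i = l * k..<l * k + k. 1 + of_int (int (i mod k) - int (i div k)) * x) =
        (\<Prod>j<k. 1 + of_int (int ((l * k + j) mod k) - int ((l * k + j) div k)) * x)"
      by (rule shift)
    also have "\<dots> = (\<Prod>j<k. 1 + of_int (int j - int l) * x)"
      by (intro prod.cong refl) simp
    finally show "(\<Prod>i = l * k..<l * k + k. 1 + of_int (int (i mod k) - int (i div k)) * x) =
        (\<Prod>j<k. 1 + of_int (int j - int l) * x)" .
  qed
  also have "\<dots> = (\<Prod>(l, j)\<in>{..<n} \<times> {..<k}. 1 + of_int (int j - int l) * x)"
    by (rule prod.cartesian_product)
  also have "{..<n} \<times> {..<k} = young_diagram (replicate n k)"
    by (auto simp: young_diagram_def)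
  finally show ?thesis
    by (simp add: content_poly_def)
qed

section \<open>Alpha-determinants of matrices with permuted or repeated columns\<close>

definition diagonal_product :: "complex mat \<Rightarrow> (nat \<Rightarrow> nat) \<Rightarrow> complex" where
  "diagonal_product B p = (\<Prod>j = 0..<dim_col B. B $$ (p j, j))"

lemma alpha_det_mult_perm_matrix:
  assumes B: "B \<in> carrier_mat N N" and s: "s permutes {0..<N}"
  shows "alpha_det \<alpha> (B * perm_matrix N s) =
    (\<Sum>p | p permutes {0..<N}. \<alpha> ^ nu N p * diagonal_product B (p \<circ> inv s))"
proof -
  have entry: "(B * perm_matrix N s) $$ (p j, j) = B $$ (p j, s j)"
    if "p permutes {0..<N}" "j \<in> {0..<N}" for p j
  proof -
    have "p j < N" "s j < N"
      using that s permutes_in_image[of p "{0..<N}" j] permutes_in_image[of s "{0..<N}" j] by auto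
    then show ?thesis
      using B that by (simp add: perm_matrix_def scalar_prod_def if_distrib cong: if_cong)
  qed
  have prod: "(\<Prod>j = 0..<N. B $$ (p j, s j)) = diagonal_product B (p \<circ> inv s)" for p
    using prod.permute[OF s, of "\<lambda>j. B $$ (p (inv s j), j)"] B permutes_inverses[OF s]
    by (simp add: diagonal_product_def o_def)
  have "alpha_det \<alpha> (B * perm_matrix N s) =
      (\<Sum>p | p permutes {0..<N}. \<alpha> ^ nu N p * (\<Prod>j = 0..<N. (B * perm_matrix N s) $$ (p j, j)))"
    using B by (simp add: alpha_det_def perm_matrix_def)
  also have "\<dots> = (\<Sum>p | p permutes {0..<N}. \<alpha> ^ nu N p * (\<Prod>j = 0..<N. B $$ (p j, s j)))"
    by (intro sum.cong refl arg_cong2[of _ _ _ _ "(*)"] prod.cong) (simp_all add: entry)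
  finally show ?thesis
    by (simp add: prod)
qed

text \<open>
  Reordering the factors moves \<open>h\<close> from the row index to the column index, and columns of one block
  are equal.
\<close>

lemma diagonal_product_varpi_invariant:
  assumes A: "A \<in> carrier_mat (n * k) n" and p: "p permutes {0..<n * k}"
    and "l < n" and h: "h permutes {l * k..<l * k + k}"
  shows "diagonal_product (varpi k A) (p \<circ> h) = diagonal_product (varpi k A) p"
proof -
  let ?N = "n * k"
  have "Suc l * k \<le> ?N"
    using \<open>l < n\<close> by (intro mult_le_mono1) simp
  then have hN: "h permutes {0..<?N}"
    using h by (auto intro: permutes_subset)
  have col: "h j div k = j div k" for j
  proof (cases "j \<in> {l * k..<l * k + k}")
    case True
    then have "h j \<in> {l * k..<l * k + k}"
      using permutes_in_image[OF h] by blast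
    moreover have "i div k = l" if "i \<in> {l * k..<l * k + k}" for i
      using that by (intro div_nat_eqI) (auto simp: mult.commute)
    ultimately show ?thesis
      using True by metis
  next
    case False
    then show ?thesis
      using permutes_not_in[OF h] by simp
  qed
  have dim: "dim_col (varpi k A) = ?N"
    using varpi_carrier[OF A, of k] by simp
  have entry: "varpi k A $$ (q j, j) = A $$ (q j, j div k)"
    if "q permutes {0..<?N}" "j \<in> {0..<?N}" for q j
    using that permutes_in_image[of q "{0..<?N}" j] by (intro varpi_index[OF A]) auto
  have "diagonal_product (varpi k A) (p \<circ> h) = (\<Prod>j = 0..<?N. A $$ (p (h j), j div k))"
    unfolding diagonal_product_def dim
    using entry[OF permutes_compose[OF hN p]] by (intro prod.cong) auto
  also have "\<dots> = (\<Prod>j = 0..<?N. A $$ (p (h j), h j div k))"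
    by (simp add: col)
  also have "\<dots> = (\<Prod>j = 0..<?N. A $$ (p j, j div k))"
    using prod.permute[OF hN, of "\<lambda>j. A $$ (p j, j div k)"] by (simp add: o_def)
  also have "\<dots> = diagonal_product (varpi k A) p"
    unfolding diagonal_product_def dim using entry[OF p] by (intro prod.cong) auto
  finally show ?thesis .
qed

theorem theorem2p2:
  fixes k n :: nat and \<alpha> :: complex and A :: "complex mat"
  assumes "k \<ge> 1" and "n \<ge> 1" and "A \<in> carrier_mat (k * n) n"
  shows "(\<Sum>\<sigma> | \<sigma> permutes {0..<k * n}.
            (- 1 / of_nat k) ^ nu (k * n) \<sigma> * alpha_det \<alpha> (varpi k A * perm_matrix (k * n) \<sigma>))
         = content_poly (replicate n k) \<alpha> * wrdet k A"
proof -
  let ?N = "n * k"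
  let ?c = "- 1 / of_nat k :: complex"
  define w where "w = diagonal_product (varpi k A)"
  define G where "G = nu_conv ?N ?c w"
  have A: "A \<in> carrier_mat ?N n"
    using assms(3) by (simp add: mult.commute)
  note B = varpi_carrier[OF A, of k]
  have "(\<Sum>\<sigma> | \<sigma> permutes {0..<?N}. ?c ^ nu ?N \<sigma> * alpha_det \<alpha> (varpi k A * perm_matrix ?N \<sigma>)) =
      (\<Sum>\<sigma> | \<sigma> permutes {0..<?N}. \<Sum>p | p permutes {0..<?N}.
        \<alpha> ^ nu ?N p * (?c ^ nu ?N \<sigma> * w (p \<circ> inv \<sigma>)))"
    by (intro sum.cong refl)
       (simp add: alpha_det_mult_perm_matrix[OF B] w_def sum_distrib_left mult.left_commute)
  also have "\<dots> = (\<Sum>p | p permutes {0..<?N}. \<alpha> ^ nu ?N p *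
      (\<Sum>\<sigma> | \<sigma> permutes {0..<?N}. ?c ^ nu ?N \<sigma> * w (p \<circ> inv \<sigma>)))"
    by (subst sum.swap) (simp add: sum_distrib_left)
  also have "\<dots> = (\<Sum>p | p permutes {0..<?N}. \<alpha> ^ nu ?N p * G p)"
  proof (intro sum.cong refl arg_cong2[of _ _ _ _ "(*)"])
    fix p
    have "(\<Sum>\<sigma> | \<sigma> permutes {0..<?N}. ?c ^ nu ?N \<sigma> * w (p \<circ> inv \<sigma>)) =
        (\<Sum>\<sigma> | \<sigma> permutes {0..<?N}. ?c ^ nu ?N (inv \<sigma>) * w (p \<circ> inv \<sigma>))"
      by (intro sum.cong refl) (simp add: nu_inv)
    also have "\<dots> = G p"
      unfolding G_def nu_conv_def by (rule sum_permutations_inverse[symmetric])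
    finally show "(\<Sum>\<sigma> | \<sigma> permutes {0..<?N}. ?c ^ nu ?N \<sigma> * w (p \<circ> inv \<sigma>)) = G p" .
  qed
  also have "\<dots> = (\<Prod>i<?N. 1 + of_int (int (i mod k) - int (i div k)) * \<alpha>) * G id"
    unfolding G_def
    using nu_conv_jucys_murphy[OF assms(1), of _ n _ w] diagonal_product_varpi_invariant[OF A]
    by (intro sum_power_nu_eigenvalues) (auto simp: w_def)
  also have "\<dots> = content_poly (replicate n k) \<alpha> * G id"
    using assms(1) by (simp add: content_poly_rectangle_row_reading)
  also have "G id = wrdet k A"
    using B by (simp add: G_def nu_conv_def w_def wrdet_def alpha_det_def diagonal_product_def)
  finally show ?thesis
    by (simp add: mult.commute[of k n])
qed

end
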